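(* Let $\Lambda=\{(\rho,u,m)\in\mathbb{R}\times\mathbb{R}^2\times\mathbb{R}^2:\ |\rho|^2=|u|^2\}$ and $$U=\Bigl\{(\rho,u,m)\in\mathbb{R}\times\mathbb{R}^2\times\mathbb{R}^2:\ |\rho|<1,\ \bigl|m-\tfrac12\rho u\bigr|<\tfrac12(1-\rho^2)\Bigr\}.$$ There exists a constant $c>0$ with the following property: for any $(\rho,u,m)\in U$ there exists $(\bar\rho,\bar u,\bar m)\in\Lambda$ with $|\bar\rho|^2+|\bar m|^2=1$ such that $$(\rho,u,m)+t(\bar\rho,\bar u,\bar m)\in U\quad\text{for all } t\in\mathbb{R}\text{ with }|t|<c(1-\rho^2).$$
   Context: The set $U$ is the interior of the $\Lambda$-convex hull of $K=\{(\rho,u,m):\ |\rho|=1,\ m=\tfrac12\rho u\}$; only the explicit description of $U$ given in the claim is needed. *)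

theory Defs
  imports "HOL-Analysis.Analysis"
begin

definition wave_cone :: "(real \<times> (real ^ 2) \<times> (real ^ 2)) set"
  where "wave_cone = {(\<rho>, u, m). \<bar>\<rho>\<bar>\<^sup>2 = (norm u)\<^sup>2}"

definition hull_interior :: "(real \<times> (real ^ 2) \<times> (real ^ 2)) set"
  where "hull_interior =
    {(\<rho>, u, m). \<bar>\<rho>\<bar> < 1 \<and> norm (m - (1 / 2 * \<rho>) *\<^sub>R u) < 1 / 2 * (1 - \<rho>\<^sup>2)}"

end

theory Submission
  imports Defs
begin

text \<open>
  Write \<open>w = m - \<rho> u / 2\<close>, and let \<open>e\<close> be a unit vector in the direction of \<open>w\<close>.
  Along the line \<open>(\<rho>, u, m) + s (1, e, (u - \<rho> e) / 2)\<close>, which points in a wave cone direction,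
  the vector \<open>w\<close> stays a multiple of \<open>e\<close>: it becomes \<open>(\<bar>w\<bar> - \<rho> s - s\<^sup>2 / 2) e\<close>. The bound
  \<open>(1 - \<rho>\<^sup>2) / 2\<close> becomes \<open>(1 - \<rho>\<^sup>2) / 2 - \<rho> s - s\<^sup>2 / 2\<close>. Both quantities thus change by the same
  amount, so the gap between the coefficient of \<open>e\<close> and the bound is conserved, however small
  it is. The line can leave the set only when the coefficient of \<open>e\<close> becomes too negative or
  \<open>\<bar>\<rho> + s\<bar>\<close> reaches 1, and either takes a step of at least a fixed multiple of \<open>1 - \<rho>\<^sup>2\<close>, uniformly
  in \<open>u\<close> and \<open>m\<close>.

  The first component of the direction is 1, so it has length at least 1 in \<open>(\<rho>, m)\<close>.
  Normalizing it therefore only shortens the steps, even if \<open>u\<close> is large.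
\<close>

lemma unit_direction:
  fixes w :: "'a::euclidean_space"
  obtains e where "norm e = 1" "w = norm w *\<^sub>R e"
proof (cases "w = 0")
  case True
  obtain e :: 'a where "norm e = 1"
    using vector_choose_size[of 1] by auto
  then show ?thesis using that True by simp
next
  case False
  then show ?thesis using that[of "sgn w"] by (simp add: norm_sgn sgn_div_norm)
qed

text \<open>
  Among the constants that keep the coefficient of \<open>e\<close> above minus its bound, 1/5 is a round
  choice: this requires \<open>2 \<rho> s + s\<^sup>2 < (1 - \<rho>\<^sup>2) / 2\<close>, and for \<open>\<bar>s\<bar> < (1 - \<rho>\<^sup>2) / 5\<close> the left side is
  at most \<open>(2/5 + 1/25) (1 - \<rho>\<^sup>2)\<close>.
\<close>

lemma step_bounds:
  fixes \<rho> s :: real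
  assumes \<rho>: "\<bar>\<rho>\<bar> < 1" and s: "\<bar>s\<bar> < (1 - \<rho>\<^sup>2) / 5"
  shows "\<bar>\<rho> + s\<bar> < 1" and "2 * \<rho> * s + s\<^sup>2 < (1 - \<rho>\<^sup>2) / 2"
proof -
  have "1 - \<rho>\<^sup>2 = (1 - \<bar>\<rho>\<bar>) * (1 + \<bar>\<rho>\<bar>)"
    by (simp add: algebra_simps power2_eq_square)
  also have "\<dots> \<le> (1 - \<bar>\<rho>\<bar>) * 2"
    using \<rho> by (intro mult_left_mono) auto
  finally show "\<bar>\<rho> + s\<bar> < 1"
    using s \<rho> abs_triangle_ineq[of \<rho> s] by argo
  have "\<rho> * s \<le> \<bar>\<rho>\<bar> * \<bar>s\<bar>" by (metis abs_ge_self abs_mult)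
  also have "\<dots> \<le> 1 * \<bar>s\<bar>" using \<rho> by (intro mult_right_mono) auto
  finally have lin: "\<rho> * s \<le> \<bar>s\<bar>" by simp
  have "\<bar>s\<bar> \<le> 1 / 5" using s by (smt (verit) zero_le_power2 divide_right_mono)
  then have "\<bar>s\<bar> * \<bar>s\<bar> \<le> 1 / 5 * \<bar>s\<bar>" by (intro mult_right_mono) auto
  then have "s\<^sup>2 \<le> \<bar>s\<bar> / 5" by (simp add: power2_eq_square)
  with lin s show "2 * \<rho> * s + s\<^sup>2 < (1 - \<rho>\<^sup>2) / 2" by argo
qed

lemma hull_interior_segment:
  fixes u m e :: "real ^ 2"
  assumes U: "(\<rho>, u, m) \<in> hull_interior"
    and e: "norm e = 1"
    and w: "m - (1 / 2 * \<rho>) *\<^sub>R u = norm (m - (1 / 2 * \<rho>) *\<^sub>R u) *\<^sub>R e"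
    and s: "\<bar>s\<bar> < (1 - \<rho>\<^sup>2) / 5"
  shows "(\<rho>, u, m) + s *\<^sub>R (1, e, (1 / 2) *\<^sub>R (u - \<rho> *\<^sub>R e)) \<in> hull_interior"
proof -
  define r where "r = norm (m - (1 / 2 * \<rho>) *\<^sub>R u)"
  have \<rho>: "\<bar>\<rho>\<bar> < 1" and r: "0 \<le> r" "r < 1 / 2 * (1 - \<rho>\<^sup>2)"
    using U by (auto simp: hull_interior_def r_def)
  have m: "m = (1 / 2 * \<rho>) *\<^sub>R u + r *\<^sub>R e"
    using w unfolding r_def by (metis add.commute diff_add_cancel)
  have collinear: "m + s *\<^sub>R ((1 / 2) *\<^sub>R (u - \<rho> *\<^sub>R e)) - (1 / 2 * (\<rho> + s)) *\<^sub>R (u + s *\<^sub>R e)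
      = (r - \<rho> * s - s\<^sup>2 / 2) *\<^sub>R e"
    unfolding m by (simp add: vec_eq_iff field_simps power2_eq_square)
  have "\<bar>r - \<rho> * s - s\<^sup>2 / 2\<bar> < 1 / 2 * (1 - (\<rho> + s)\<^sup>2)"
    using r step_bounds(2)[OF \<rho> s] by (simp add: power2_sum abs_less_iff field_simps)
  then have "norm (m + s *\<^sub>R ((1 / 2) *\<^sub>R (u - \<rho> *\<^sub>R e)) - (1 / 2 * (\<rho> + s)) *\<^sub>R (u + s *\<^sub>R e))
      < 1 / 2 * (1 - (\<rho> + s)\<^sup>2)"
    unfolding collinear by (simp add: e)
  with step_bounds(1)[OF \<rho> s] show ?thesis
    by (simp add: hull_interior_def)
qed

theorem proposition3p1:
  "\<exists>c::real. c > 0 \<and>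
    (\<forall>\<rho> u m. (\<rho>, u, m) \<in> hull_interior \<longrightarrow>
      (\<exists>\<rho>' u' m'. (\<rho>', u', m') \<in> wave_cone \<and> \<bar>\<rho>'\<bar>\<^sup>2 + (norm m')\<^sup>2 = 1 \<and>
        (\<forall>t::real. \<bar>t\<bar> < c * (1 - \<rho>\<^sup>2) \<longrightarrow>
          (\<rho>, u, m) + t *\<^sub>R (\<rho>', u', m') \<in> hull_interior)))"
proof (rule exI[of _ "1 / 5"], intro conjI allI impI)
  fix \<rho> :: real and u m :: "real ^ 2"
  assume U: "(\<rho>, u, m) \<in> hull_interior"
  obtain e where e: "norm e = 1"
    and w: "m - (1 / 2 * \<rho>) *\<^sub>R u = norm (m - (1 / 2 * \<rho>) *\<^sub>R u) *\<^sub>R e"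
    by (rule unit_direction)
  define n where "n = (1 / 2) *\<^sub>R (u - \<rho> *\<^sub>R e)"
  define a where "a = 1 / sqrt (1 + (norm n)\<^sup>2)"
  have pos: "1 + (norm n)\<^sup>2 > 0"
    by (simp add: add_pos_nonneg)
  then have a: "0 < a" "a \<le> 1" and a2: "a\<^sup>2 = 1 / (1 + (norm n)\<^sup>2)"
    by (auto simp: a_def power_divide)
  show "\<exists>\<rho>' u' m'. (\<rho>', u', m') \<in> wave_cone \<and> \<bar>\<rho>'\<bar>\<^sup>2 + (norm m')\<^sup>2 = 1 \<and>
        (\<forall>t::real. \<bar>t\<bar> < 1 / 5 * (1 - \<rho>\<^sup>2) \<longrightarrow>
          (\<rho>, u, m) + t *\<^sub>R (\<rho>', u', m') \<in> hull_interior)"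
  proof (intro exI conjI allI impI)
    show "(a, a *\<^sub>R e, a *\<^sub>R n) \<in> wave_cone"
      by (simp add: wave_cone_def e)
    have "\<bar>a\<bar>\<^sup>2 + (norm (a *\<^sub>R n))\<^sup>2 = a\<^sup>2 * (1 + (norm n)\<^sup>2)"
      by (simp add: power_mult_distrib algebra_simps)
    then show "\<bar>a\<bar>\<^sup>2 + (norm (a *\<^sub>R n))\<^sup>2 = 1"
      using a2 pos by simp
  next
    fix t :: real
    assume t: "\<bar>t\<bar> < 1 / 5 * (1 - \<rho>\<^sup>2)"
    have "\<bar>t * a\<bar> \<le> \<bar>t\<bar>"
      using a by (simp add: abs_mult mult_left_le)
    with t have "\<bar>t * a\<bar> < (1 - \<rho>\<^sup>2) / 5" by simp
    from hull_interior_segment[OF U e w this]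
    show "(\<rho>, u, m) + t *\<^sub>R (a, a *\<^sub>R e, a *\<^sub>R n) \<in> hull_interior"
      by (simp add: n_def)
  qed
qed simp

end
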